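(* In the payment network creation game with $n$ players, betweenness weight $b\ge 0$ and closeness weight $c>0$, the price of stability is $\mathrm{PoS}=\mathcal{O}(1)$ for $c>1$, and also for $b+c<\frac{1}{n^2}$; i.e., there is an absolute constant $C$ such that $\mathrm{PoS}\le C$ for all $n,b,c$ with $c>1$ or $b+c<\frac1{n^2}$.
   Context: Payment network creation game. There are $n\ge 2$ players $[n]=\{0,1,\dots,n-1\}$. A strategy of player $u$ is a set $s_u\subseteq [n]\setminus\{u\}$ (the players to whom $u$ opens a channel). A strategy combination is $s=(s_0,\dots,s_{n-1})$, and $G[s]$ is the undirected simple graph on $[n]$ in which $u,v$ are adjacent iff $v\in s_u$ or $u\in s_v$. With weights $b\ge 0$ and $c>0$, the cost of $u$ is $$\mathrm{cost}_u(s)=|s_u|+b\cdot \mathrm{betweenness}_u(s)+c\cdot \mathrm{closeness}_u(s),$$ $$\mathrm{betweenness}_u(s)=(n-1)(n-2)-\sum_{\substack{(i,j)\in[n]^2:\ i\ne j,\ i\neq u,\ j\ne u,\\ m(i,j)>0}}\frac{m_u(i,j)}{m(i,j)},\qquad \mathrm{closeness}_u(s)=\sum_{v\in[n]\setminus\{u\}}\bigl(d_{G[s]}(u,v)-1\bigr).$$ The sum in the betweenness runs over ordered pairs; $m(i,j)$ is the number of shortest paths between $i$ and $j$ in $G[s]$ and $m_u(i,j)$ the number of those passing through $u$; $d_{G[s]}$ is graph distance, equal to $\infty$ between different components. The social cost is $\mathrm{cost}(s)=\sum_{u}\mathrm{cost}_u(s)$. A strategy combination is a Nash equilibrium if no player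 can strictly decrease her cost by unilaterally changing her strategy; equilibrium graphs are taken to be connected (a player's cost is infinite in a disconnected graph, and disconnected strategy combinations are not regarded as equilibria). With $S$ the set of all strategy combinations and $N$ the set of Nash equilibria, $\mathrm{PoS}=\dfrac{\min_{s\in N}\mathrm{cost}(s)}{\min_{s\in S}\mathrm{cost}(s)}$. *)

theory Defs
  imports "Graph_Theory.Graph_Theory" "HOL-Library.FuncSet" "HOL-Library.Extended_Real"
begin

text \<open>
  Players are \<open>0, \<dots>, n - 1\<close>. A strategy combination is extensional: outside the set of players
  it has the default value \<open>undefined\<close>, so that the set of strategy combinations is finite.
\<close>

definition strategies :: "nat \<Rightarrow> nat \<Rightarrow> nat set set" where
  "strategies n u = Pow ({..<n} - {u})"

definition strategy_combinations :: "nat \<Rightarrow> (nat \<Rightarrow> nat set) set" where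
  "strategy_combinations n = (\<Pi>\<^sub>E u\<in>{..<n}. strategies n u)"

text \<open>
  As usual in this library, an undirected simple graph is a digraph without loops whose arc relation
  is symmetric (the locale \<open>pair_graph\<close>); an undirected path between \<open>i\<close> and \<open>j\<close> then corresponds
  to exactly one arc path from \<open>i\<close> to \<open>j\<close>.
\<close>

definition channel_graph :: "nat \<Rightarrow> (nat \<Rightarrow> nat set) \<Rightarrow> nat pair_pre_digraph" where
  "channel_graph n s =
     \<lparr>pverts = {..<n}, parcs = {(u, v). u < n \<and> v < n \<and> (v \<in> s u \<or> u \<in> s v)}\<rparr>"

lemma pair_graph_channel_graph:
  assumes "s \<in> strategy_combinations n"
  shows "pair_graph (channel_graph n s)"
proof -
  have fin: "finite {(u, v). u < n \<and> v < n \<and> (v \<in> s u \<or> u \<in> s v)}"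
    by (rule finite_subset[of _ "{..<n} \<times> {..<n}"]) auto
  have "u \<notin> s u" if "u < n" for u
    using assms that by (auto simp: strategy_combinations_def strategies_def PiE_iff)
  then show ?thesis
    using fin by unfold_locales
      (auto simp: channel_graph_def symmetric_def arcs_ends_def arc_to_ends_def with_proj_def
        intro!: symI)
qed

text \<open>Graph distance is the library's shortest-path cost with unit weights; it is \<open>\<infinity>\<close> when no path
  exists.\<close>

definition distance :: "nat \<Rightarrow> (nat \<Rightarrow> nat set) \<Rightarrow> nat \<Rightarrow> nat \<Rightarrow> ereal" where
  "distance n s i j = wf_digraph.\<mu> (with_proj (channel_graph n s)) (\<lambda>_. 1) i j"

definition shortest_paths :: "nat \<Rightarrow> (nat \<Rightarrow> nat set) \<Rightarrow> nat \<Rightarrow> nat \<Rightarrow> (nat \<times> nat) awalk set" where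
  "shortest_paths n s i j =
     {p. pre_digraph.apath (with_proj (channel_graph n s)) i p j \<and>
         ereal (real (length p)) = distance n s i j}"

definition shortest_paths_through ::
    "nat \<Rightarrow> (nat \<Rightarrow> nat set) \<Rightarrow> nat \<Rightarrow> nat \<Rightarrow> nat \<Rightarrow> (nat \<times> nat) awalk set" where
  "shortest_paths_through n s u i j =
     {p \<in> shortest_paths n s i j.
        u \<in> set (pre_digraph.awalk_verts (with_proj (channel_graph n s)) i p)}"

definition betweenness :: "nat \<Rightarrow> (nat \<Rightarrow> nat set) \<Rightarrow> nat \<Rightarrow> real" where
  "betweenness n s u =
     (real n - 1) * (real n - 2) -
     (\<Sum>(i, j) \<in> {(i, j). i < n \<and> j < n \<and> i \<noteq> j \<and> i \<noteq> u \<and> j \<noteq> u \<and>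
                          card (shortest_paths n s i j) > 0}.
        real (card (shortest_paths_through n s u i j)) / real (card (shortest_paths n s i j)))"

definition closeness :: "nat \<Rightarrow> (nat \<Rightarrow> nat set) \<Rightarrow> nat \<Rightarrow> ereal" where
  "closeness n s u = (\<Sum>v \<in> {..<n} - {u}. distance n s u v - 1)"

definition player_cost :: "nat \<Rightarrow> real \<Rightarrow> real \<Rightarrow> (nat \<Rightarrow> nat set) \<Rightarrow> nat \<Rightarrow> ereal" where
  "player_cost n b c s u =
     ereal (real (card (s u))) + ereal b * ereal (betweenness n s u) + ereal c * closeness n s u"

definition social_cost :: "nat \<Rightarrow> real \<Rightarrow> real \<Rightarrow> (nat \<Rightarrow> nat set) \<Rightarrow> ereal" where
  "social_cost n b c s = (\<Sum>u<n. player_cost n b c s u)"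

definition nash_equilibria :: "nat \<Rightarrow> real \<Rightarrow> real \<Rightarrow> (nat \<Rightarrow> nat set) set" where
  "nash_equilibria n b c =
     {s \<in> strategy_combinations n.
        Digraph_Component.connected (with_proj (channel_graph n s)) \<and>
        (\<forall>u<n. \<forall>t \<in> strategies n u. \<not> player_cost n b c (s(u := t)) u < player_cost n b c s u)}"

text \<open>
  Both infima range over finite sets, hence are minima whenever the set is nonempty. If there were no
  equilibrium, the numerator would be \<open>\<infinity>\<close>, and so would be the quotient (for \<open>n \<ge> 2\<close> the
  denominator is positive and finite). Thus a finite upper bound on the price of stability includes
  the existence of an equilibrium.
\<close>

definition price_of_stability :: "nat \<Rightarrow> real \<Rightarrow> real \<Rightarrow> ereal" where
  "price_of_stability n b c =
     (INF s \<in> nash_equilibria n b c. social_cost n b c s) /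
     (INF s \<in> strategy_combinations n. social_cost n b c s)"

lemma finite_strategy_combinations: "finite (strategy_combinations n)"
  unfolding strategy_combinations_def strategies_def by (intro finite_PiE) auto

lemma finite_nash_equilibria: "finite (nash_equilibria n b c)"
  unfolding nash_equilibria_def using finite_strategy_combinations by simp

end

theory Submission
  imports Defs
begin

text \<open>
  For \<open>c > 1\<close> the complete graph is an equilibrium: dropping \<open>k\<close> channels saves \<open>k\<close> and costs \<open>c k\<close>,
  while the betweenness stays maximal because the other players remain adjacent. In every finite
  combination, channels plus closeness sum to at least half the number of ordered pairs, and distances
  are on average so short that the total betweenness is at least half of its maximum.

  For \<open>b + c < 1 / n\<^sup>2\<close> the star whose leaves pay is an equilibrium: a leaf with two or more channels
  pays at least one more than before, which no gain in betweenness and closeness outweighs. Its social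
  cost is at most twice the \<open>n - 1\<close> channels that any connected graph needs.
\<close>

section \<open>Distances in channel graphs\<close>

abbreviation adjacent :: "nat \<Rightarrow> (nat \<Rightarrow> nat set) \<Rightarrow> nat \<Rightarrow> nat \<Rightarrow> bool" where
  "adjacent n s u v \<equiv> (u, v) \<in> parcs (channel_graph n s)"

lemma adjacent_iff: "adjacent n s u v \<longleftrightarrow> u < n \<and> v < n \<and> (v \<in> s u \<or> u \<in> s v)"
  by (simp add: channel_graph_def)

lemma strategyD:
  assumes "s \<in> strategy_combinations n" "u < n"
  shows "s u \<subseteq> {..<n} - {u}"
  using assms by (auto simp: strategy_combinations_def strategies_def PiE_iff)

lemma finite_strategy: "s \<in> strategy_combinations n \<Longrightarrow> u < n \<Longrightarrow> finite (s u)"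
  by (meson strategyD finite_Diff finite_lessThan finite_subset)

lemma strategy_update:
  assumes "s \<in> strategy_combinations n" "u < n" "t \<in> strategies n u"
  shows "s(u := t) \<in> strategy_combinations n"
  using assms by (auto simp: strategy_combinations_def PiE_iff extensional_def)

lemma distance_le_walk:
  assumes "s \<in> strategy_combinations n"
    and "pre_digraph.awalk (with_proj (channel_graph n s)) i p j"
  shows "distance n s i j \<le> ereal (real (length p))"
proof -
  interpret pair_graph "channel_graph n s"
    using assms(1) by (rule pair_graph_channel_graph)
  have "awalk_cost (\<lambda>_. 1) q = real (length q)" for q
    by (induction q) auto
  then show ?thesis
    using min_cost_le_walk_cost[OF assms(2), of "\<lambda>_. 1"] by (simp add: distance_def)
qed

text \<open>Finiteness of the distance means reachability. With nonnegative weights the infimum over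
  walks is then attained by a path, so a shortest path exists.\<close>

lemma distance_attained:
  assumes "s \<in> strategy_combinations n" and "distance n s i j \<noteq> \<infinity>"
  obtains p where "pre_digraph.apath (with_proj (channel_graph n s)) i p j"
    "distance n s i j = ereal (real (length p))"
proof -
  interpret pair_graph "channel_graph n s"
    using assms(1) by (rule pair_graph_channel_graph)
  have cost: "awalk_cost (\<lambda>_. 1) q = real (length q)" for q
    by (induction q) auto
  have "i \<rightarrow>\<^sup>*\<^bsub>with_proj (channel_graph n s)\<^esub> j"
    using assms(2) by (simp add: distance_def flip: \<mu>_reach_conv[of "\<lambda>_. 1"])
  from min_cost_awalk[OF this, of "\<lambda>_. 1"] that show thesis
    by (auto simp: distance_def cost)
qed

lemma connected_if_distance_finite:
  assumes "s \<in> strategy_combinations n" "n > 0"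
    and "\<And>i j. i < n \<Longrightarrow> j < n \<Longrightarrow> distance n s i j \<noteq> \<infinity>"
  shows "Digraph_Component.connected (with_proj (channel_graph n s))"
proof -
  interpret pair_graph "channel_graph n s"
    using assms(1) by (rule pair_graph_channel_graph)
  have "i \<rightarrow>\<^sup>*\<^bsub>with_proj (channel_graph n s)\<^esub> j" if "i < n" "j < n" for i j
    using assms(3)[OF that] by (simp add: distance_def flip: \<mu>_reach_conv[of "\<lambda>_. 1"])
  then have "strongly_connected (with_proj (channel_graph n s))"
    using assms(2) by (auto simp: strongly_connected_def channel_graph_def)
  then show ?thesis
    by (auto simp: Digraph_Component.connected_def strongly_connected_def reachable_mk_symmetricI)
qed

text \<open>Excludes \<open>-\<infinity>\<close> and fractional values: a finite distance is the
  length of an attaining path.\<close>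

lemma distance_cases:
  assumes "s \<in> strategy_combinations n"
  obtains "distance n s i j = \<infinity>" | k where "distance n s i j = ereal (real k)"
  using assms distance_attained by metis

lemma distance_ge_1:
  assumes "s \<in> strategy_combinations n" "i \<noteq> j"
  shows "1 \<le> distance n s i j"
proof (cases "distance n s i j = \<infinity>")
  case False
  interpret pair_graph "channel_graph n s"
    using assms(1) by (rule pair_graph_channel_graph)
  obtain p where p: "apath i p j" "distance n s i j = ereal (real (length p))"
    using distance_attained[OF assms(1) False] by metis
  then have "p \<noteq> []" using assms(2) by (auto simp: apath_Nil_iff)
  then show ?thesis using p(2) by (cases p) (auto simp: one_ereal_def)
qed simp

lemma distance_ge_2:
  assumes "s \<in> strategy_combinations n" "i \<noteq> j" "\<not> adjacent n s i j"
  shows "2 \<le> distance n s i j"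
proof (cases "distance n s i j = \<infinity>")
  case False
  interpret pair_graph "channel_graph n s"
    using assms(1) by (rule pair_graph_channel_graph)
  obtain p where p: "apath i p j" "distance n s i j = ereal (real (length p))"
    using distance_attained[OF assms(1) False] by metis
  have "length p \<ge> 2"
  proof (rule ccontr)
    assume "\<not> length p \<ge> 2"
    then consider "p = []" | e where "p = [e]" by (cases p; cases "tl p") auto
    then show False
      using p(1) assms(2,3) by cases (auto simp: apath_simps)
  qed
  then show ?thesis using p(2) by simp
qed simp

lemma distance_le_1:
  assumes "s \<in> strategy_combinations n" "adjacent n s i j"
  shows "distance n s i j \<le> 1"
proof -
  interpret pair_graph "channel_graph n s"
    using assms(1) by (rule pair_graph_channel_graph)
  have "awalk i [(i, j)] j"
    using assms(2) by (auto simp: awalk_simps in_arcsD2)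
  from distance_le_walk[OF assms(1) this] show ?thesis by (simp add: one_ereal_def)
qed

lemma distance_le_2:
  assumes "s \<in> strategy_combinations n" "adjacent n s i k" "adjacent n s k j"
  shows "distance n s i j \<le> 2"
proof -
  interpret pair_graph "channel_graph n s"
    using assms(1) by (rule pair_graph_channel_graph)
  have "awalk i [(i, k), (k, j)] j"
    using assms(2,3) by (auto simp: awalk_simps in_arcsD2)
  from distance_le_walk[OF assms(1) this] show ?thesis by simp
qed

lemma distance_self:
  assumes "s \<in> strategy_combinations n" "i < n"
  shows "distance n s i i = 0"
proof -
  interpret pair_graph "channel_graph n s"
    using assms(1) by (rule pair_graph_channel_graph)
  have "awalk i [] i"
    using assms(2) by (simp add: awalk_Nil_iff) (simp add: channel_graph_def)
  from distance_le_walk[OF assms(1) this] have "distance n s i i \<le> 0" by (simp add: zero_ereal_def)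
  then show ?thesis
    by (cases rule: distance_cases[OF assms(1), of i i]) auto
qed

text \<open>The vertex before \<open>j\<close> on a shortest path works. It comes from the exact
  triangle equality for \<open>\<mu>\<close>, which asks for distinct endpoints; these are distinct
  because the distance is positive.\<close>

lemma distance_predecessor:
  assumes "s \<in> strategy_combinations n" "distance n s i j = ereal (real (Suc k))"
  obtains v where "adjacent n s v j" "distance n s i v = ereal (real k)"
proof -
  interpret pair_graph "channel_graph n s"
    using assms(1) by (rule pair_graph_channel_graph)
  have fin: "distance n s i j \<noteq> \<infinity>" using assms(2) by simp
  obtain p where p: "apath i p j" "distance n s i j = ereal (real (length p))"
    using distance_attained[OF assms(1) fin] by metis
  have "j \<noteq> i"
  proof
    assume "j = i"
    then have "p = []" using apath_nonempty_ends[OF p(1)] by auto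
    then show False using p assms(2) by simp
  qed
  moreover have "i \<rightarrow>\<^sup>*\<^bsub>with_proj (channel_graph n s)\<^esub> j"
    using p(1) by (auto simp: apath_def intro: reachable_awalkI)
  ultimately obtain v e where "distance n s i j = distance n s i v + ereal 1" "arc e (v, j)"
    using mu_exact_triangle[of j i "\<lambda>_. 1"] unfolding distance_def by (metis zero_le_one)
  then show thesis
    using that[of v] assms(2)
    by (cases "distance n s i v") (auto simp: arc_def)
qed

section \<open>Closeness and the number of channels\<close>

lemma closeness_eq_sum:
  assumes "\<And>v. v < n \<Longrightarrow> distance n s u v = ereal (real (f v))"
  shows "closeness n s u = ereal (\<Sum>v \<in> {..<n} - {u}. real (f v) - 1)"
proof -
  have "closeness n s u = (\<Sum>v \<in> {..<n} - {u}. ereal (real (f v) - 1))"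
    unfolding closeness_def by (rule sum.cong) (auto simp: assms one_ereal_def)
  then show ?thesis by simp
qed

lemma closeness_nonneg:
  assumes "s \<in> strategy_combinations n"
  shows "0 \<le> closeness n s u"
  unfolding closeness_def
proof (rule sum_nonneg)
  fix v assume "v \<in> {..<n} - {u}"
  then have "1 \<le> distance n s u v" by (intro distance_ge_1[OF assms]) auto
  then show "0 \<le> distance n s u v - 1" by (cases "distance n s u v") (auto simp: one_ereal_def)
qed

lemma closeness_infinite:
  assumes "s \<in> strategy_combinations n" "u < n" "v < n" "distance n s u v = \<infinity>"
  shows "closeness n s u = \<infinity>"
proof -
  have "u \<noteq> v" using assms distance_self by fastforce
  then show ?thesis
    using assms unfolding closeness_def by (subst sum_Pinfty) (auto intro!: bexI[of _ v])
qed

text \<open>For nonempty \<open>S\<close>, downward closure makes the values fill an initial segment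
  \<open>{..m}\<close>, so the maximum \<open>m\<close> is below \<open>card S\<close>. A maximal
  element is deleted and induction applied; the extremal values are
  \<open>0, ..., card S - 1\<close>.\<close>

lemma sum_le_if_image_downward_closed:
  fixes f :: "'a \<Rightarrow> nat"
  assumes "finite S" "\<And>x k. x \<in> S \<Longrightarrow> k < f x \<Longrightarrow> k \<in> f ` S"
  shows "2 * sum f S \<le> card S * (card S - 1)"
  using assms
proof (induction "card S" arbitrary: S)
  case 0
  then show ?case by simp
next
  case (Suc N)
  then have ne: "S \<noteq> {}" by auto
  define m where "m = Max (f ` S)"
  have "m \<in> f ` S" unfolding m_def using Suc.prems(1) ne by simp
  then obtain x where x: "x \<in> S" "f x = m" by auto
  have le: "f y \<le> m" if "y \<in> S" for y
    unfolding m_def using Suc.prems(1) that by simp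
  have "{..m} \<subseteq> f ` S"
    using Suc.prems(2)[OF x(1)] x by (auto simp: le_less)
  then have "card {..m} \<le> card S"
    by (meson Suc.prems(1) card_image_le card_mono finite_imageI le_trans)
  then have m: "m \<le> N" using Suc.hyps(2) by simp
  have "N = card (S - {x})" using Suc.hyps(2) x(1) Suc.prems(1) by simp
  \<comment> \<open>Deleting \<open>x\<close> can only lose the value \<open>m\<close>, and a value
    strictly below some \<open>f y\<close> is not \<open>m\<close>.\<close>
  moreover have "k \<in> f ` (S - {x})" if y: "y \<in> S - {x}" "k < f y" for y k
  proof -
    obtain z where "z \<in> S" "f z = k" using Suc.prems(2)[of y k] y by auto
    moreover have "k \<noteq> m" using le[of y] y by auto
    ultimately show ?thesis using x(2) by blast
  qed
  ultimately have IH: "2 * sum f (S - {x}) \<le> N * (N - 1)"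
    using Suc.hyps(1)[of "S - {x}"] Suc.prems(1) by simp
  have "sum f S = m + sum f (S - {x})"
    using sum.remove[OF Suc.prems(1) x(1), of f] x(2) by simp
  then have "2 * sum f S \<le> 2 * N + N * (N - 1)" using IH m by simp
  also have "\<dots> = Suc N * N" by (cases N) auto
  finally show ?case using Suc.hyps(2) by (metis diff_Suc_1)
qed

text \<open>The vertices of a connected graph occupy every distance from \<open>u\<close> up to the largest one,
  so a path starting in \<open>u\<close> is the worst case.\<close>

lemma closeness_le:
  assumes s: "s \<in> strategy_combinations n" and u: "u < n"
    and f: "\<And>v. v < n \<Longrightarrow> distance n s u v = ereal (real (f v))"
  shows "(\<Sum>v \<in> {..<n} - {u}. real (f v) - 1) \<le> (real n - 1) * (real n - 2) / 2"
proof -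
  have pred: "k \<in> f ` {..<n}" if v: "v < n" "f v = Suc k" for v k
  proof -
    obtain w where w: "adjacent n s w v" "distance n s u w = ereal (real k)"
      using distance_predecessor[OF s] f[OF v(1)] v(2) by metis
    then have "w < n" by (simp add: adjacent_iff)
    then show ?thesis using f w(2) by force
  qed
  have "k \<in> f ` {..<n}" if "v \<in> {..<n}" "k < f v" for v k
  proof -
    \<comment> \<open>Descends from \<open>v\<close> towards \<open>u\<close> one unit of distance
      at a time, so that every smaller distance is hit.\<close>
    have "f v - j \<in> f ` {..<n}" if "j \<le> f v" for j
      using that
    proof (induction j)
      case (Suc j)
      then obtain w where "w < n" "f w = f v - j" by auto
      with pred[of w "f v - Suc j"] Suc.prems show ?case by simp
    qed (use \<open>v \<in> {..<n}\<close> in auto)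
    from this[of "f v - k"] that(2) show ?thesis by simp
  qed
  from sum_le_if_image_downward_closed[OF _ this]
  have "2 * sum f {..<n} \<le> n * (n - 1)" by simp
  then have "real (2 * sum f {..<n}) \<le> real (n * (n - 1))" by (simp only: of_nat_le_iff)
  then have "2 * (\<Sum>v<n. real (f v)) \<le> real n * (real n - 1)"
    using u by (simp add: of_nat_diff)
  \<comment> \<open>Since \<open>u\<close> adds nothing to the full sum, subtracting 1 for each of
    the other \<open>n - 1\<close> players turns the bound \<open>n (n - 1) / 2\<close> into
    \<open>(n - 1) (n - 2) / 2\<close>.\<close>
  moreover have "f u = 0" using distance_self[OF s u] f[OF u] by simp
  then have "(\<Sum>v \<in> {..<n} - {u}. real (f v) - 1) = (\<Sum>v<n. real (f v)) - (real n - 1)"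
    using u by (simp add: sum_subtractf sum.remove[of "{..<n}" u] of_nat_diff)
  ultimately show ?thesis by (simp add: field_simps)
qed

lemma card_strategies_eq:
  assumes "s \<in> strategy_combinations n"
  shows "(\<Sum>u<n. card (s u)) = card (SIGMA u:{..<n}. s u)"
  using finite_strategy[OF assms] by (simp add: card_SigmaI)

text \<open>Each player other than \<open>0\<close> is the endpoint farther from \<open>0\<close> of some channel.\<close>

lemma channels_ge_if_connected:
  assumes s: "s \<in> strategy_combinations n" and n: "n > 0"
    and fin: "\<And>v. v < n \<Longrightarrow> distance n s 0 v \<noteq> \<infinity>"
  shows "n - 1 \<le> (\<Sum>u<n. card (s u))"
proof -
  have "\<forall>v<n. \<exists>k. distance n s 0 v = ereal (real k)"
    using distance_cases[OF s] fin by metis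
  then obtain f where f: "\<And>v. v < n \<Longrightarrow> distance n s 0 v = ereal (real (f v))"
    by metis
  \<comment> \<open>Surjectivity uses the channel between \<open>v\<close> and a predecessor
    \<open>w\<close>. Their distances from 0 differ, so the channel is sent to \<open>v\<close>
    whichever of the two buys it.\<close>
  define far where "far = (\<lambda>(u, v). if f u < f v then v else u)"
  have "{1..<n} \<subseteq> far ` (SIGMA u:{..<n}. s u)"
  proof
    fix v assume v: "v \<in> {1..<n}"
    then have "1 \<le> distance n s 0 v" using distance_ge_1[OF s] by simp
    then have "f v \<ge> 1" using f v by (simp add: one_ereal_def)
    then obtain k where k: "f v = Suc k" by (cases "f v") auto
    obtain w where w: "adjacent n s w v" "distance n s 0 w = ereal (real k)"
      using distance_predecessor[OF s] f k v by (metis atLeastLessThan_iff)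
    then have "w < n" by (simp add: adjacent_iff)
    then have "f w = k" using f w(2) by force
    then have "far (w, v) = v" "far (v, w) = v" using k by (auto simp: far_def)
    moreover have "(w, v) \<in> (SIGMA u:{..<n}. s u) \<or> (v, w) \<in> (SIGMA u:{..<n}. s u)"
      using w(1) by (auto simp: adjacent_iff)
    ultimately show "v \<in> far ` (SIGMA u:{..<n}. s u)" by (metis image_eqI)
  qed
  moreover have "finite (SIGMA u:{..<n}. s u)" using finite_strategy[OF s] by auto
  ultimately have "card {1..<n} \<le> card (SIGMA u:{..<n}. s u)" by (rule surj_card_le[rotated])
  then show ?thesis using card_strategies_eq[OF s] by simp
qed

text \<open>Every ordered pair of players is either covered by a channel, in one of its two directions,
  or contributes at least one to the closeness.\<close>

lemma pairs_le_channels_closeness: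
  assumes s: "s \<in> strategy_combinations n"
    and D: "\<And>u v. u < n \<Longrightarrow> v < n \<Longrightarrow> distance n s u v = ereal (real (D u v))"
  shows "real n * (real n - 1)
    \<le> 2 * real (\<Sum>u<n. card (s u)) + (\<Sum>u<n. \<Sum>v \<in> {..<n} - {u}. real (D u v) - 1)"
proof -
  let ?P = "SIGMA u:{..<n}. {..<n} - {u}" and ?A = "SIGMA u:{..<n}. s u"
  have fin: "finite ?A" using finite_strategy[OF s] by auto
  have sub: "?A \<subseteq> ?P" using strategyD[OF s] by auto
  have "real n * (real n - 1) = (\<Sum>u<n. \<Sum>v \<in> {..<n} - {u}. 1)"
    by (cases n) (auto simp: card_Diff_singleton_if)
  also have "\<dots> = (\<Sum>x \<in> ?P. 1)"
    by (subst sum.Sigma) (auto simp: case_prod_beta)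
  \<comment> \<open>A pair joined by a channel lies in \<open>?A\<close> or its converse; any other
    pair has distance at least 2 and is covered by the last summand. The converse is as large as
    \<open>?A\<close>, hence the factor 2.\<close>
  also have "\<dots> \<le> (\<Sum>x \<in> ?P. of_bool (x \<in> ?A) + of_bool (x \<in> ?A\<inverse>) + (real (D (fst x) (snd x)) - 1))"
  proof (rule sum_mono)
    fix x assume x: "x \<in> ?P"
    obtain u v where uv: "x = (u, v)" by (cases x)
    have *: "u < n" "v < n" "u \<noteq> v" using x uv by auto
    have 1: "1 \<le> D u v" using distance_ge_1[OF s *(3)] D[OF *(1,2)] by (simp add: one_ereal_def)
    have 2: "2 \<le> D u v" if "\<not> adjacent n s u v"
      using distance_ge_2[OF s *(3) that] D[OF *(1,2)] by simp
    show "1 \<le> of_bool (x \<in> ?A) + of_bool (x \<in> ?A\<inverse>) + (real (D (fst x) (snd x)) - 1)"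
      using 1 2 * uv by (auto simp: adjacent_iff of_bool_def)
  qed
  also have "\<dots> = real (card ?A) + real (card (?A\<inverse>)) + (\<Sum>x \<in> ?P. real (D (fst x) (snd x)) - 1)"
  proof -
    have "?P \<inter> {x. x \<in> ?A} = ?A" "?P \<inter> {x. x \<in> ?A\<inverse>} = ?A\<inverse>" using sub by auto
    then show ?thesis by (simp only: sum.distrib sum_of_bool_eq finite_SigmaI finite_lessThan finite_Diff)
  qed
  also have "(\<Sum>x \<in> ?P. real (D (fst x) (snd x)) - 1) = (\<Sum>u<n. \<Sum>v \<in> {..<n} - {u}. real (D u v) - 1)"
    by (subst sum.Sigma) (auto simp: case_prod_beta)
  finally show ?thesis using card_strategies_eq[OF s] by simp
qed

section \<open>Betweenness\<close>

text \<open>Infinite sets have cardinality 0, so the hypothesis makes the set of shortest paths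
  finite.\<close>

lemma card_through_le:
  assumes "card (shortest_paths n s i j) > 0"
  shows "card (shortest_paths_through n s u i j) \<le> card (shortest_paths n s i j)"
  using assms by (intro card_mono) (auto simp: shortest_paths_through_def card_gt_0_iff)

lemma betweenness_le: "betweenness n s u \<le> (real n - 1) * (real n - 2)"
  unfolding betweenness_def by (auto intro!: sum_nonneg)

text \<open>Each fraction is at most 1, and exactly \<open>(n - 1) (n - 2)\<close> ordered pairs of
  distinct players avoid \<open>u\<close>.\<close>

lemma betweenness_nonneg:
  assumes "u < n"
  shows "0 \<le> betweenness n s u"
proof -
  let ?Q = "{(i, j). i < n \<and> j < n \<and> i \<noteq> j \<and> i \<noteq> u \<and> j \<noteq> u \<and> card (shortest_paths n s i j) > 0}"
  let ?I = "SIGMA i:{..<n} - {u}. {..<n} - {u, i}"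
  have "(\<Sum>(i, j) \<in> ?Q. real (card (shortest_paths_through n s u i j)) / real (card (shortest_paths n s i j)))
      \<le> (\<Sum>x \<in> ?Q. 1)"
    using card_through_le by (intro sum_mono) (auto simp: divide_le_eq_1)
  also have "\<dots> = real (card ?Q)" by simp
  also have "\<dots> \<le> real (card ?I)"
    by (intro of_nat_mono card_mono) auto
  also have "card ?I = (\<Sum>i \<in> {..<n} - {u}. n - 2)"
    using assms by (subst card_SigmaI) (auto intro!: sum.cong simp: card_Diff_subset)
  also have "\<dots> = (n - 1) * (n - 2)" using assms by simp
  also have "real \<dots> = (real n - 1) * (real n - 2)"
    using assms by (cases "n = 1") (auto simp: of_nat_diff)
  finally show ?thesis by (simp add: betweenness_def)
qed

text \<open>The neighbours of an interior vertex on a simple path are distinct. Contrapositively, a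
  player with a single neighbour, or one whose fellow players are all mutually adjacent, lies on no
  shortest path between others.\<close>

lemma interior_vertex:
  assumes s: "s \<in> strategy_combinations n"
    and p: "p \<in> shortest_paths_through n s u i j" and u: "u \<noteq> i" "u \<noteq> j"
  obtains x z where "x \<noteq> z" "adjacent n s x u" "adjacent n s u z" "2 \<le> distance n s i j"
proof -
  interpret pair_graph "channel_graph n s"
    using s by (rule pair_graph_channel_graph)
  have p': "apath i p j" "ereal (real (length p)) = distance n s i j" "u \<in> set (pawalk_verts i p)"
    using p by (auto simp: shortest_paths_through_def shortest_paths_def awalk_verts_with_proj_eq)
  then have cas: "pcas i p j" by (auto simp: apath_def)
  \<comment> \<open>Apart from \<open>i\<close>, the vertices of the path are the heads of its
    arcs.\<close>
  have "\<exists>x. (x, u) \<in> set p"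
    using p'(3) u(1) awalk_verts_conv'[OF cas] cas by (cases p) force+
  then obtain x where "(x, u) \<in> set p" by blast
  from apath_succ_decomp[OF p'(1) this u(2)] obtain p1 z p2
    where d: "p = p1 @ (x, u) # (u, z) # p2" "x \<noteq> z" by blast
  have "set p \<subseteq> parcs (channel_graph n s)" using p'(1) by (auto simp: apath_def)
  moreover have "2 \<le> distance n s i j" using d(1) by (simp flip: p'(2))
  ultimately show thesis using that[of x z] d by auto
qed

lemma betweenness_eq_max:
  assumes "\<And>i j. i < n \<Longrightarrow> j < n \<Longrightarrow> i \<noteq> j \<Longrightarrow> i \<noteq> u \<Longrightarrow> j \<noteq> u
    \<Longrightarrow> shortest_paths_through n s u i j = {}"
  shows "betweenness n s u = (real n - 1) * (real n - 2)"
  unfolding betweenness_def using assms by (auto intro!: sum.neutral)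

text \<open>Double counting of players and shortest paths through them: each shortest path has at
  most \<open>d - 1\<close> interior vertices, and the division cancels the number of paths.\<close>

lemma sum_interior_fractions_le:
  assumes s: "s \<in> strategy_combinations n" and ij: "i < n" "j < n" "i \<noteq> j"
    and d: "distance n s i j = ereal (real d)"
  shows "(\<Sum>u \<in> {..<n} - {i, j}. real (card (shortest_paths_through n s u i j)) / real (card (shortest_paths n s i j)))
    \<le> real d - 1"
proof -
  let ?S = "shortest_paths n s i j" and ?U = "{..<n} - {i, j}"
  interpret pair_graph "channel_graph n s"
    using s by (rule pair_graph_channel_graph)
  have d1: "d \<ge> 1" using distance_ge_1[OF s ij(3)] d by (simp add: one_ereal_def)
  show ?thesis
  proof (cases "card ?S = 0")
    case True
    \<comment> \<open>Division by zero is 0, so the left side vanishes and \<open>d \<ge> 1\<close>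
      suffices.\<close>
    then show ?thesis using d1 by simp
  next
    case False
    then have fin: "finite ?S" by (metis card.infinite)
    have "(\<Sum>u \<in> ?U. card (shortest_paths_through n s u i j))
        = (\<Sum>u \<in> ?U. \<Sum>p \<in> ?S. of_bool (u \<in> set (pawalk_verts i p)))"
      using fin by (simp add: shortest_paths_through_def awalk_verts_with_proj_eq Int_def)
    also have "\<dots> = (\<Sum>p \<in> ?S. \<Sum>u \<in> ?U. of_bool (u \<in> set (pawalk_verts i p)))"
      by (rule sum.swap)
    also have "\<dots> \<le> (\<Sum>p \<in> ?S. d - 1)"
    proof (rule sum_mono)
      fix p assume "p \<in> ?S"
      then have p: "awalk i p j" "length p = d"
        using d by (auto simp: shortest_paths_def apath_def)
      let ?V = "set (pawalk_verts i p)"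
      have "last (pawalk_verts i p) = j" using p(1) by simp
      then have V: "i \<in> ?V" "j \<in> ?V"
        using hd_in_awalk_verts(1)[OF p(1)] last_in_set[OF awalk_verts_non_Nil, of i p] by simp_all
      \<comment> \<open>A walk of length \<open>d\<close> lists \<open>d + 1\<close> vertices;
        removing both ends leaves at most \<open>d - 1\<close>.\<close>
      have "card ?V \<le> Suc d"
        using card_length[of "pawalk_verts i p"] length_awalk_verts[of i p] p(2) by simp
      moreover have "card (?V - {i, j}) = card ?V - 2"
        using V ij(3) by (subst card_Diff_subset) auto
      moreover have "card (?U \<inter> ?V) \<le> card (?V - {i, j})" by (intro card_mono) auto
      ultimately show "(\<Sum>u \<in> ?U. of_bool (u \<in> ?V)) \<le> d - 1" by (simp add: Int_def)
    qed
    finally have "(\<Sum>u \<in> ?U. card (shortest_paths_through n s u i j)) \<le> card ?S * (d - 1)" by simp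
    then have "real (\<Sum>u \<in> ?U. card (shortest_paths_through n s u i j)) \<le> real (card ?S * (d - 1))"
      by (simp only: of_nat_le_iff)
    then have "(\<Sum>u \<in> ?U. real (card (shortest_paths_through n s u i j))) \<le> (real d - 1) * real (card ?S)"
      using d1 by (simp add: of_nat_diff mult.commute)
    then show ?thesis using False by (simp add: divide_le_eq flip: sum_divide_distrib)
  qed
qed

text \<open>A shortest path of length \<open>d\<close> has \<open>d - 1\<close> interior vertices, so what all players together lose
  in closeness they can at most regain in betweenness.\<close>

lemma sum_betweenness_ge:
  assumes s: "s \<in> strategy_combinations n"
    and D: "\<And>u v. u < n \<Longrightarrow> v < n \<Longrightarrow> distance n s u v = ereal (real (D u v))"
  shows "real n * ((real n - 1) * (real n - 2)) - (\<Sum>u<n. \<Sum>v \<in> {..<n} - {u}. real (D u v) - 1)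
    \<le> (\<Sum>u<n. betweenness n s u)"
proof -
  define r where "r u x = real (card (shortest_paths_through n s u (fst x) (snd x)))
    / real (card (shortest_paths n s (fst x) (snd x)))" for u x
  let ?P = "SIGMA u:{..<n}. {..<n} - {u}"
  define Q where "Q u = {(i, j). i < n \<and> j < n \<and> i \<noteq> j \<and> i \<noteq> u \<and> j \<noteq> u \<and> card (shortest_paths n s i j) > 0}"
    for u
  \<comment> \<open>Moving the condition on \<open>u\<close> into the summand makes the index set
    \<open>?P\<close> independent of \<open>u\<close>, so the sums can be swapped and each pair
    bounded separately.\<close>
  have "(\<Sum>u<n. \<Sum>x \<in> Q u. r u x) \<le> (\<Sum>u<n. \<Sum>x \<in> ?P. if u \<notin> {fst x, snd x} then r u x else 0)"
  proof (rule sum_mono)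
    fix u
    have "(\<Sum>x \<in> Q u. r u x) \<le> (\<Sum>x \<in> {x \<in> ?P. u \<notin> {fst x, snd x}}. r u x)"
      by (rule sum_mono2) (auto simp: Q_def r_def)
    then show "(\<Sum>x \<in> Q u. r u x) \<le> (\<Sum>x \<in> ?P. if u \<notin> {fst x, snd x} then r u x else 0)"
      by (subst sum.inter_filter[symmetric]) auto
  qed
  also have "\<dots> = (\<Sum>x \<in> ?P. \<Sum>u<n. if u \<notin> {fst x, snd x} then r u x else 0)"
    by (rule sum.swap)
  also have "\<dots> \<le> (\<Sum>x \<in> ?P. real (D (fst x) (snd x)) - 1)"
  proof (rule sum_mono)
    fix x assume x: "x \<in> ?P"
    have "(\<Sum>u<n. if u \<notin> {fst x, snd x} then r u x else 0) = (\<Sum>u \<in> {..<n} - {fst x, snd x}. r u x)"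
      by (subst sum.inter_filter[symmetric]) (auto intro!: sum.cong)
    also have "\<dots> \<le> real (D (fst x) (snd x)) - 1"
      unfolding r_def using x by (intro sum_interior_fractions_le[OF s]) (auto simp: D)
    finally show "(\<Sum>u<n. if u \<notin> {fst x, snd x} then r u x else 0) \<le> real (D (fst x) (snd x)) - 1" .
  qed
  also have "\<dots> = (\<Sum>u<n. \<Sum>v \<in> {..<n} - {u}. real (D u v) - 1)"
    by (subst sum.Sigma) (auto simp: case_prod_beta)
  finally have "(\<Sum>u<n. \<Sum>x \<in> Q u. r u x) \<le> (\<Sum>u<n. \<Sum>v \<in> {..<n} - {u}. real (D u v) - 1)" .
  moreover have "betweenness n s u = (real n - 1) * (real n - 2) - (\<Sum>x \<in> Q u. r u x)" for u
    by (simp add: betweenness_def Q_def r_def case_prod_beta)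
  ultimately show ?thesis by (simp add: sum_subtractf)
qed

section \<open>Costs\<close>

lemma player_cost_ge:
  assumes "b \<ge> 0" "c \<ge> 0" "B \<le> betweenness n s u" "ereal X \<le> closeness n s u"
  shows "ereal (real (card (s u)) + b * B + c * X) \<le> player_cost n b c s u"
proof -
  have "ereal (c * X) \<le> ereal c * closeness n s u"
    using ereal_mult_left_mono[OF assms(4), of "ereal c"] assms(2) by simp
  moreover have "ereal (real (card (s u)) + b * B) \<le> ereal (real (card (s u))) + ereal b * ereal (betweenness n s u)"
    using assms(1,3) by (simp add: mult_left_mono)
  ultimately have "ereal (real (card (s u)) + b * B) + ereal (c * X) \<le> player_cost n b c s u"
    unfolding player_cost_def by (rule add_mono[rotated])
  then show ?thesis by simp
qed

lemma player_cost_le: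
  assumes "b \<ge> 0" "c \<ge> 0" "closeness n s u \<le> ereal X"
  shows "player_cost n b c s u \<le> ereal (real (card (s u)) + b * ((real n - 1) * (real n - 2)) + c * X)"
proof -
  have "ereal c * closeness n s u \<le> ereal (c * X)"
    using ereal_mult_left_mono[OF assms(3), of "ereal c"] assms(2) by simp
  moreover have "ereal (real (card (s u))) + ereal b * ereal (betweenness n s u)
      \<le> ereal (real (card (s u)) + b * ((real n - 1) * (real n - 2)))"
    using assms(1) betweenness_le by (simp add: mult_left_mono)
  ultimately have "player_cost n b c s u
      \<le> ereal (real (card (s u)) + b * ((real n - 1) * (real n - 2))) + ereal (c * X)"
    unfolding player_cost_def by (rule add_mono[rotated])
  then show ?thesis by simp
qed

lemma player_cost_infinite:
  assumes "c > 0" "closeness n s u = \<infinity>"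
  shows "player_cost n b c s u = \<infinity>"
  using assms by (simp add: player_cost_def)

text \<open>Moves from extended to ordinary reals: either some distance is infinite, which a
  positive \<open>c\<close> passes on to the social cost, or all distances are natural numbers and
  the cost is a real expression.\<close>

lemma social_cost_cases:
  assumes s: "s \<in> strategy_combinations n" and c: "c > 0"
  obtains "social_cost n b c s = \<infinity>"
  | D where "\<And>u v. u < n \<Longrightarrow> v < n \<Longrightarrow> distance n s u v = ereal (real (D u v))"
    "social_cost n b c s = ereal (real (\<Sum>u<n. card (s u)) + b * (\<Sum>u<n. betweenness n s u)
      + c * (\<Sum>u<n. \<Sum>v \<in> {..<n} - {u}. real (D u v) - 1))"
proof (cases "\<exists>u<n. \<exists>v<n. distance n s u v = \<infinity>")
  case True
  then obtain u v where uv: "u < n" "v < n" "distance n s u v = \<infinity>" by blast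
  then have "player_cost n b c s u = \<infinity>"
    using closeness_infinite[OF s] player_cost_infinite[OF c] by blast
  then have "social_cost n b c s = \<infinity>"
    unfolding social_cost_def using uv(1) by (subst sum_Pinfty) auto
  then show ?thesis by (rule that(1))
next
  case False
  then have "\<forall>u v. \<exists>k. u < n \<and> v < n \<longrightarrow> distance n s u v = ereal (real k)"
    using distance_cases[OF s] by metis
  then obtain D where D: "\<And>u v. u < n \<Longrightarrow> v < n \<Longrightarrow> distance n s u v = ereal (real (D u v))"
    by metis
  have "player_cost n b c s u = ereal (real (card (s u)) + b * betweenness n s u
      + c * (\<Sum>v \<in> {..<n} - {u}. real (D u v) - 1))" if "u < n" for u
    using closeness_eq_sum[of n s u "D u"] D that by (simp add: player_cost_def)
  then have "social_cost n b c s = (\<Sum>u<n. ereal (real (card (s u)) + b * betweenness n s u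
      + c * (\<Sum>v \<in> {..<n} - {u}. real (D u v) - 1)))"
    unfolding social_cost_def by (intro sum.cong) auto
  then have "social_cost n b c s = ereal (real (\<Sum>u<n. card (s u)) + b * (\<Sum>u<n. betweenness n s u)
      + c * (\<Sum>u<n. \<Sum>v \<in> {..<n} - {u}. real (D u v) - 1))"
    by (simp add: sum.distrib sum_distrib_left)
  with D show ?thesis by (rule that(2))
qed

lemma sum_closeness_nonneg:
  assumes s: "s \<in> strategy_combinations n"
    and D: "\<And>u v. u < n \<Longrightarrow> v < n \<Longrightarrow> distance n s u v = ereal (real (D u v))"
  shows "0 \<le> (\<Sum>u<n. \<Sum>v \<in> {..<n} - {u}. real (D u v) - 1)"
proof (intro sum_nonneg)
  fix u v assume "u \<in> {..<n}" "v \<in> {..<n} - {u}"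
  then show "0 \<le> real (D u v) - 1"
    using distance_ge_1[OF s, of u v] D[of u v] by (simp add: one_ereal_def)
qed

section \<open>Lower bounds on the social cost of arbitrary strategy combinations\<close>

lemma social_cost_ge_channels:
  assumes s: "s \<in> strategy_combinations n" and "n > 0" "b \<ge> 0" "c > 0"
  shows "ereal (real n - 1) \<le> social_cost n b c s"
proof (cases rule: social_cost_cases[OF s \<open>c > 0\<close>, of b])
  case (2 D)
  have "n - 1 \<le> (\<Sum>u<n. card (s u))"
    using channels_ge_if_connected[OF s \<open>n > 0\<close>] 2(1) \<open>n > 0\<close> by simp
  then have "real n - 1 \<le> real (\<Sum>u<n. card (s u))" using \<open>n > 0\<close> by linarith
  moreover have "0 \<le> b * (\<Sum>u<n. betweenness n s u)"
    using assms(3) by (intro mult_nonneg_nonneg sum_nonneg betweenness_nonneg) auto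
  moreover have "0 \<le> c * (\<Sum>u<n. \<Sum>v \<in> {..<n} - {u}. real (D u v) - 1)"
    using assms(4) sum_closeness_nonneg[OF s 2(1)] by simp
  ultimately show ?thesis unfolding 2(2) by simp
qed simp

text \<open>With \<open>A\<close> purchased channels and total closeness \<open>R\<close>, one has
  \<open>n (n - 1) \<le> 2 A + R \<le> 2 (A + c R)\<close>. Moreover \<open>R\<close> is at most
  half of \<open>n (n - 1) (n - 2)\<close>, so the total betweenness, which is at least this number
  minus \<open>R\<close>, is at least half of it.\<close>

lemma social_cost_ge_if_closeness_dominates:
  assumes s: "s \<in> strategy_combinations n" and "b \<ge> 0" "c \<ge> 1"
  shows "ereal ((real n * (real n - 1) + b * (real n * ((real n - 1) * (real n - 2)))) / 2)
    \<le> social_cost n b c s"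
proof -
  have c: "c > 0" using assms(3) by simp
  show ?thesis
  proof (cases rule: social_cost_cases[OF s c, of b])
    case (2 D)
    define R where "R = (\<Sum>u<n. \<Sum>v \<in> {..<n} - {u}. real (D u v) - 1)"
    have "R \<le> (\<Sum>u<n. (real n - 1) * (real n - 2) / 2)"
      unfolding R_def by (intro sum_mono closeness_le[OF s]) (auto simp: 2(1))
    then have R: "R \<le> real n * ((real n - 1) * (real n - 2)) / 2" by simp
    have "real n * ((real n - 1) * (real n - 2)) / 2 \<le> (\<Sum>u<n. betweenness n s u)"
      using sum_betweenness_ge[OF s 2(1)] R unfolding R_def[symmetric] by linarith
    then have "b * (real n * ((real n - 1) * (real n - 2)) / 2) \<le> b * (\<Sum>u<n. betweenness n s u)"
      using assms(2) by (rule mult_left_mono)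
    moreover have "R \<le> c * R"
      using sum_closeness_nonneg[OF s 2(1)] assms(3) unfolding R_def[symmetric]
      by (simp add: mult_le_cancel_right1)
    moreover have "real n * (real n - 1) \<le> 2 * real (\<Sum>u<n. card (s u)) + R"
      unfolding R_def by (rule pairs_le_channels_closeness[OF s 2(1)])
    moreover have "0 \<le> R" unfolding R_def by (rule sum_closeness_nonneg[OF s 2(1)])
    ultimately show ?thesis unfolding 2(2) R_def[symmetric] by simp
  qed simp
qed

section \<open>Closeness estimates by counting non-neighbours\<close>

lemma closeness_ge_nonadjacent:
  assumes s: "s \<in> strategy_combinations n"
    and K: "K \<subseteq> {..<n} - {u}" "\<And>v. v \<in> K \<Longrightarrow> \<not> adjacent n s u v"
  shows "ereal (real (card K)) \<le> closeness n s u"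
proof -
  have "{..<n} \<inter> K = K" "({..<n} - {u}) \<inter> K = K" using K(1) by auto
  then have "ereal (real (card K)) = (\<Sum>v \<in> {..<n} - {u}. ereal (of_bool (v \<in> K)))"
    by simp
  also have "\<dots> \<le> closeness n s u"
    unfolding closeness_def
  proof (rule sum_mono)
    fix v assume v: "v \<in> {..<n} - {u}"
    then have "1 \<le> distance n s u v" by (intro distance_ge_1[OF s]) auto
    moreover have "2 \<le> distance n s u v" if "v \<in> K"
      using v K(2)[OF that] by (intro distance_ge_2[OF s]) auto
    ultimately show "ereal (of_bool (v \<in> K)) \<le> distance n s u v - 1"
      by (cases "distance n s u v"; cases "v \<in> K") (auto simp: one_ereal_def)
  qed
  finally show ?thesis .
qed

text \<open>Players in \<open>K\<close> contribute at most 1 each, the others at most 0. The set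
  \<open>K\<close> is empty for the complete graph, consists of the other leaves for a leaf of the
  star, and can be taken larger for a cruder bound.\<close>

lemma closeness_le_nonadjacent:
  assumes s: "s \<in> strategy_combinations n"
    and K: "K \<subseteq> {..<n} - {u}" "\<And>v. v \<in> K \<Longrightarrow> distance n s u v \<le> 2"
      "\<And>v. v \<in> {..<n} - {u} - K \<Longrightarrow> adjacent n s u v"
  shows "closeness n s u \<le> ereal (real (card K))"
proof -
  have "closeness n s u \<le> (\<Sum>v \<in> {..<n} - {u}. ereal (of_bool (v \<in> K)))"
    unfolding closeness_def
  proof (rule sum_mono)
    fix v assume v: "v \<in> {..<n} - {u}"
    have "distance n s u v \<le> 1" if "v \<notin> K"
      using v that by (intro distance_le_1[OF s] K(3)) auto
    then show "distance n s u v - 1 \<le> ereal (of_bool (v \<in> K))"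
      using K(2)[of v] by (cases "distance n s u v"; cases "v \<in> K") (auto simp: one_ereal_def)
  qed
  also have "\<dots> = ereal (real (card K))"
  proof -
    have "{..<n} \<inter> K = K" "({..<n} - {u}) \<inter> K = K" using K(1) by auto
    then show ?thesis by simp
  qed
  finally show ?thesis .
qed

text \<open>Settles the deviation of a leaf of the star that drops its only channel without
  replacement.\<close>

lemma distance_isolated:
  assumes s: "s \<in> strategy_combinations n" and "u \<noteq> v" "\<And>w. \<not> adjacent n s u w"
  shows "distance n s u v = \<infinity>"
proof (rule ccontr)
  interpret pair_graph "channel_graph n s"
    using s by (rule pair_graph_channel_graph)
  assume "distance n s u v \<noteq> \<infinity>"
  then obtain p where "apath u p v" using distance_attained[OF s] by metis
  then show False using assms(2,3) by (cases p) (auto simp: apath_simps)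
qed

section \<open>The complete graph and the star as equilibria\<close>

text \<open>Every channel is bought exactly once, by the endpoint with the larger index.\<close>

definition complete_profile :: "nat \<Rightarrow> nat \<Rightarrow> nat set" where
  "complete_profile n = (\<lambda>u\<in>{..<n}. {..<u})"

lemma complete_profile_strategies: "complete_profile n \<in> strategy_combinations n"
  by (auto simp: complete_profile_def strategy_combinations_def strategies_def)

lemma adjacent_complete: "adjacent n (complete_profile n) u v \<longleftrightarrow> u < n \<and> v < n \<and> u \<noteq> v"
  by (auto simp: adjacent_iff complete_profile_def)

lemma player_cost_complete_le:
  assumes "b \<ge> 0" "c \<ge> 0" "u < n"
  shows "player_cost n b c (complete_profile n) u \<le> ereal (real u + b * ((real n - 1) * (real n - 2)))"
proof -
  have "closeness n (complete_profile n) u \<le> ereal (real (card ({} :: nat set)))"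
    using assms(3) by (intro closeness_le_nonadjacent[OF complete_profile_strategies])
      (auto simp: adjacent_complete)
  from player_cost_le[OF assms(1,2) this] show ?thesis
    using assms(3) by (simp add: complete_profile_def)
qed

text \<open>Channels bought by players above \<open>u\<close> survive a deviation of
  \<open>u\<close>, so only players in \<open>{..<u} - t\<close> are lost as neighbours. Each of
  them costs at least \<open>c \<ge> 1\<close> in closeness, which offsets the saved
  channel.\<close>

lemma complete_profile_nash:
  assumes n: "n > 0" and b: "b \<ge> 0" and c: "c \<ge> 1"
  shows "complete_profile n \<in> nash_equilibria n b c"
proof -
  let ?s = "complete_profile n"
  have "distance n ?s i j \<le> 1" if "i < n" "j < n" for i j
    using distance_le_1[OF complete_profile_strategies, of i j n]
      distance_self[OF complete_profile_strategies that(1)] that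
    unfolding adjacent_complete by (cases "i = j") auto
  then have "Digraph_Component.connected (with_proj (channel_graph n ?s))"
    using n by (intro connected_if_distance_finite[OF complete_profile_strategies]) fastforce+
  moreover have "\<not> player_cost n b c (?s(u := t)) u < player_cost n b c ?s u"
    if u: "u < n" and t: "t \<in> strategies n u" for u t
  proof -
    let ?s' = "?s(u := t)"
    have s': "?s' \<in> strategy_combinations n"
      by (rule strategy_update[OF complete_profile_strategies u t])
    have "betweenness n ?s' u = (real n - 1) * (real n - 2)"
    proof (rule betweenness_eq_max, rule ccontr)
      fix i j assume ij: "i < n" "j < n" "i \<noteq> j" "i \<noteq> u" "j \<noteq> u"
        and "shortest_paths_through n ?s' u i j \<noteq> {}"
      then have "2 \<le> distance n ?s' i j" using interior_vertex[OF s'] by blast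
      \<comment> \<open>The channel between \<open>i\<close> and \<open>j\<close> does not involve
        \<open>u\<close>, so it survives and leaves no room for an interior vertex.\<close>
      moreover have "adjacent n ?s' i j"
        using ij by (auto simp: adjacent_iff complete_profile_def)
      then have "distance n ?s' i j \<le> 1" by (rule distance_le_1[OF s'])
      ultimately have "(2 :: ereal) \<le> 1" by (rule order_trans)
      then show False by simp
    qed
    moreover have "ereal (real (card ({..<u} - t))) \<le> closeness n ?s' u"
      using u by (intro closeness_ge_nonadjacent[OF s'])
        (auto simp: adjacent_iff complete_profile_def)
    ultimately have "ereal (real (card t) + b * ((real n - 1) * (real n - 2)) + c * real (card ({..<u} - t)))
        \<le> player_cost n b c ?s' u"
      using player_cost_ge[OF b, of c "(real n - 1) * (real n - 2)" n ?s' u] c by simp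
    \<comment> \<open>The new strategy may also contain redundant channels to larger players, so
      only an inequality holds.\<close>
    moreover have "finite t" using t by (auto simp: strategies_def intro: finite_subset)
    then have "card {..<u} \<le> card (t \<union> ({..<u} - t))" by (intro card_mono) auto
    then have "u \<le> card t + card ({..<u} - t)"
      using card_Un_le[of t "{..<u} - t"] by simp
    then have "real u \<le> real (card t) + real (card ({..<u} - t))" by linarith
    moreover have "real (card ({..<u} - t)) \<le> c * real (card ({..<u} - t))"
      using c by (simp add: mult_le_cancel_right1)
    ultimately have "ereal (real u + b * ((real n - 1) * (real n - 2))) \<le> player_cost n b c ?s' u"
      by (smt (verit) ereal_less_eq(3) order_trans)
    moreover have "player_cost n b c ?s u \<le> ereal (real u + b * ((real n - 1) * (real n - 2)))"
      using b c u by (intro player_cost_complete_le) auto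
    ultimately show ?thesis by (simp add: not_less)
  qed
  ultimately show ?thesis
    using complete_profile_strategies by (simp add: nash_equilibria_def)
qed

lemma social_cost_complete_le:
  assumes "b \<ge> 0" "c \<ge> 0" "n > 0"
  shows "social_cost n b c (complete_profile n)
    \<le> ereal (real n * (real n - 1) / 2 + b * (real n * ((real n - 1) * (real n - 2))))"
proof -
  have "social_cost n b c (complete_profile n)
      \<le> (\<Sum>u<n. ereal (real u + b * ((real n - 1) * (real n - 2))))"
    unfolding social_cost_def using assms by (intro sum_mono player_cost_complete_le) auto
  also have "\<dots> = ereal ((\<Sum>u<n. real u) + real n * (b * ((real n - 1) * (real n - 2))))"
    by (simp add: sum.distrib)
  also have "(\<Sum>u<n. real u) = real n * (real n - 1) / 2"
    by (induction n) (auto simp: field_simps)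
  finally show ?thesis by (simp add: algebra_simps)
qed

section \<open>The star whose leaves pay for their channels to the centre 0\<close>

definition star_profile :: "nat \<Rightarrow> nat \<Rightarrow> nat set" where
  "star_profile n = (\<lambda>u\<in>{..<n}. if u = 0 then {} else {0})"

lemma star_profile_strategies: "star_profile n \<in> strategy_combinations n"
  by (auto simp: star_profile_def strategy_combinations_def strategies_def)

lemma adjacent_star:
  "adjacent n (star_profile n) u v \<longleftrightarrow> u < n \<and> v < n \<and> u \<noteq> v \<and> (u = 0 \<or> v = 0)"
  by (auto simp: adjacent_iff star_profile_def)

lemma distance_star_le_2:
  assumes "u < n" "v < n"
  shows "distance n (star_profile n) u v \<le> 2"
proof -
  note s = star_profile_strategies
  consider "u = v" | "adjacent n (star_profile n) u v"
    | "adjacent n (star_profile n) u 0" "adjacent n (star_profile n) 0 v"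
    using assms by (auto simp: adjacent_star)
  then show ?thesis
  proof cases
    case 1
    then show ?thesis using distance_self[OF s assms(1)] by simp
  next
    case 2
    then show ?thesis using distance_le_1[OF s] order_trans[of _ 1 "2 :: ereal"] by simp
  next
    case 3
    then show ?thesis by (rule distance_le_2[OF s])
  qed
qed

lemma closeness_star_leaf_le:
  assumes "0 < u" "u < n"
  shows "closeness n (star_profile n) u \<le> ereal (real n - 2)"
proof -
  have "closeness n (star_profile n) u \<le> ereal (real (card ({..<n} - {u, 0})))"
    using assms by (intro closeness_le_nonadjacent[OF star_profile_strategies] distance_star_le_2)
      (auto simp: adjacent_star)
  also have "card ({..<n} - {u, 0}) = n - 2"
    using assms by (subst card_Diff_subset) auto
  finally show ?thesis using assms by (simp add: of_nat_diff)
qed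

text \<open>The first estimate keeps the betweenness and closeness cost of a leaf below the price of
  one channel. The second bounds the star's excess over its \<open>n - 1\<close> channels, divided
  by \<open>n - 1\<close>. Both follow from \<open>(b + c) n\<^sup>2 < 1\<close>.\<close>

lemma weights_small:
  assumes n: "n \<ge> 2" and b: "b \<ge> 0" and c: "c > 0" and small: "b + c < 1 / (real n)\<^sup>2"
  shows "b * ((real n - 1) * (real n - 2)) + c * (real n - 2) < 1"
    and "b * (real n * (real n - 2)) + c * real n < 1"
proof -
  define m where "m = real n"
  have m: "m \<ge> 2" using n unfolding m_def by simp
  have "(b + c) * m\<^sup>2 < 1"
    using small m unfolding m_def[symmetric] by (simp add: field_simps)
  then have bc: "b * m\<^sup>2 + c * m\<^sup>2 < 1" by (simp add: distrib_right)
  have "b * ((m - 1) * (m - 2)) \<le> b * m\<^sup>2" "b * (m * (m - 2)) \<le> b * m\<^sup>2"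
    using m b by (auto intro!: mult_left_mono simp: power2_eq_square algebra_simps)
  moreover have "m \<le> m\<^sup>2" using m by (simp add: power2_eq_square)
  then have "c * (m - 2) \<le> c * m\<^sup>2" "c * m \<le> c * m\<^sup>2"
    using c by (auto intro!: mult_left_mono)
  ultimately show "b * ((real n - 1) * (real n - 2)) + c * (real n - 2) < 1"
    "b * (real n * (real n - 2)) + c * real n < 1"
    using bc unfolding m_def[symmetric] by linarith+
qed

lemma star_profile_nash:
  assumes n: "n \<ge> 2" and b: "b \<ge> 0" and c: "c > 0" and small: "b + c < 1 / (real n)\<^sup>2"
  shows "star_profile n \<in> nash_equilibria n b c"
proof -
  let ?s = "star_profile n"
  have "Digraph_Component.connected (with_proj (channel_graph n ?s))"
    using n distance_star_le_2 by (intro connected_if_distance_finite[OF star_profile_strategies]) fastforce+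
  moreover have "player_cost n b c ?s u \<le> player_cost n b c (?s(u := t)) u"
    if u: "u < n" and t: "t \<in> strategies n u" for u t
  proof (cases "u = 0")
    case True
    \<comment> \<open>All leaves already pay for a channel to the centre, so channels bought by the
      centre leave the graph unchanged and only add cost.\<close>
    have "channel_graph n (?s(0 := t)) = channel_graph n ?s"
      using t True by (auto simp: channel_graph_def star_profile_def strategies_def split: if_splits)
    then have "betweenness n (?s(0 := t)) u = betweenness n ?s u"
      "closeness n (?s(0 := t)) u = closeness n ?s u"
      by (simp_all add: betweenness_def closeness_def shortest_paths_through_def
          shortest_paths_def distance_def)
    moreover have "card (?s u) = 0" using True u by (simp add: star_profile_def)
    ultimately show ?thesis
      unfolding player_cost_def using True by (intro add_mono) auto
  next
    case False
    let ?s' = "?s(u := t)"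
    have s': "?s' \<in> strategy_combinations n"
      by (rule strategy_update[OF star_profile_strategies u t])
    have fin: "finite t" using t by (auto simp: strategies_def intro: finite_subset)
    \<comment> \<open>Neither the centre nor another leaf buys a channel to \<open>u\<close>, so its
      neighbours are exactly the players in \<open>t\<close>.\<close>
    have adj: "adjacent n ?s' u v \<longleftrightarrow> v \<in> t" for v
      using t u False by (auto simp: adjacent_iff star_profile_def strategies_def split: if_splits)
    have "player_cost n b c ?s u
        \<le> ereal (real (card (?s u)) + b * ((real n - 1) * (real n - 2)) + c * (real n - 2))"
      using b c u False by (intro player_cost_le closeness_star_leaf_le) auto
    then have leaf: "player_cost n b c ?s u
        \<le> ereal (1 + b * ((real n - 1) * (real n - 2)) + c * (real n - 2))"
      using False u by (simp add: star_profile_def)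
    consider "card t = 0" | "card t = 1" | "card t \<ge> 2" by linarith
    then show ?thesis
    proof cases
      case 1
      then have "\<not> adjacent n ?s' u w" for w using fin adj by simp
      then have "distance n ?s' u 0 = \<infinity>" using distance_isolated[OF s'] False by blast
      then have "player_cost n b c ?s' u = \<infinity>"
        using u n by (intro player_cost_infinite[OF c] closeness_infinite[OF s']) auto
      then show ?thesis by simp
    next
      case 2
      then obtain v where v: "t = {v}" by (auto simp: card_1_singleton_iff)
      \<comment> \<open>The single neighbour \<open>v\<close> need not be the centre. In any case
        \<open>u\<close> is interior to no shortest path and has \<open>n - 2\<close>
        non-neighbours, so the bound \<open>leaf\<close> cannot be beaten.\<close>
      have "betweenness n ?s' u = (real n - 1) * (real n - 2)"
      proof (rule betweenness_eq_max, rule ccontr)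
        fix i j assume "i \<noteq> u" "j \<noteq> u" "shortest_paths_through n ?s' u i j \<noteq> {}"
        then obtain x z where "x \<noteq> z" "adjacent n ?s' x u" "adjacent n ?s' u z"
          using interior_vertex[OF s'] by (metis ex_in_conv)
        moreover from this have "adjacent n ?s' u x" by (auto simp: adjacent_iff)
        ultimately show False using adj v by auto
      qed
      moreover have "ereal (real (card ({..<n} - {u, v}))) \<le> closeness n ?s' u"
        by (intro closeness_ge_nonadjacent[OF s']) (use adj v in auto)
      moreover have "card ({..<n} - {u, v}) = n - 2"
        using u v t by (subst card_Diff_subset) (auto simp: strategies_def)
      ultimately have "ereal (1 + b * ((real n - 1) * (real n - 2)) + c * (real n - 2))
          \<le> player_cost n b c ?s' u"
        using player_cost_ge[OF b, of c "(real n - 1) * (real n - 2)" n ?s' u "real n - 2"] c 2 n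
        by (simp add: of_nat_diff)
      with leaf show ?thesis by (rule order_trans)
    next
      case 3
      have "ereal (real (card t)) \<le> player_cost n b c ?s' u"
        using player_cost_ge[OF b, of c 0 n ?s' u 0] c betweenness_nonneg[OF u]
          closeness_nonneg[OF s'] by (simp add: zero_ereal_def)
      moreover have "1 + b * ((real n - 1) * (real n - 2)) + c * (real n - 2) \<le> real (card t)"
        using weights_small(1)[OF n b c small] 3 by linarith
      ultimately show ?thesis using leaf by (meson ereal_less_eq(3) order_trans)
    qed
  qed
  ultimately show ?thesis
    using star_profile_strategies by (simp add: nash_equilibria_def not_less)
qed

lemma social_cost_star_le:
  assumes n: "n \<ge> 2" and b: "b \<ge> 0" and c: "c > 0" and small: "b + c < 1 / (real n)\<^sup>2"
  shows "social_cost n b c (star_profile n) \<le> ereal (2 * (real n - 1))"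
proof -
  let ?s = "star_profile n"
  have "player_cost n b c ?s u
      \<le> ereal (of_bool (u \<noteq> 0) + b * ((real n - 1) * (real n - 2)) + c * (real n - 1))"
    if "u < n" for u
  proof -
    \<comment> \<open>Even the centre is charged as if all others were at distance 2, which gives
      one bound for all players.\<close>
    have "closeness n ?s u \<le> ereal (real (card ({..<n} - {u})))"
      using that by (intro closeness_le_nonadjacent[OF star_profile_strategies] distance_star_le_2) auto
    then have "closeness n ?s u \<le> ereal (real n - 1)" using that by (simp add: of_nat_diff)
    from player_cost_le[OF b _ this, of c] show ?thesis
      using that c by (cases "u = 0") (simp_all add: star_profile_def)
  qed
  then have "social_cost n b c ?s
      \<le> (\<Sum>u<n. ereal (of_bool (u \<noteq> 0) + b * ((real n - 1) * (real n - 2)) + c * (real n - 1)))"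
    unfolding social_cost_def by (intro sum_mono) auto
  also have "\<dots> = ereal ((\<Sum>u<n. of_bool (u \<noteq> 0))
      + real n * (b * ((real n - 1) * (real n - 2))) + real n * (c * (real n - 1)))"
    by (simp add: sum.distrib)
  also have "(\<Sum>u<n. of_bool (u \<noteq> 0)) = real n - 1"
    using n by (cases n) (simp_all add: sum.lessThan_Suc_shift del: sum.lessThan_Suc)
  \<comment> \<open>Pulling out \<open>n - 1\<close> exposes the second estimate of
    \<open>weights_small\<close>.\<close>
  also have "real n - 1 + real n * (b * ((real n - 1) * (real n - 2))) + real n * (c * (real n - 1))
      = (real n - 1) * (1 + (b * (real n * (real n - 2)) + c * real n))"
    by (simp add: algebra_simps)
  also have "ereal \<dots> \<le> ereal ((real n - 1) * 2)"
    using weights_small(2)[OF n b c small] n unfolding ereal_less_eq(3)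
    by (intro mult_left_mono) auto
  finally show ?thesis by (simp add: mult.commute)
qed

section \<open>The price of stability\<close>

text \<open>A lower bound \<open>L\<close> for all combinations replaces the exact optimum. Its
  positivity makes the denominator positive, as needed for monotonicity of the division.\<close>

lemma price_of_stability_le:
  assumes eq: "s \<in> nash_equilibria n b c" "social_cost n b c s \<le> ereal (2 * L)"
    and opt: "\<And>s. s \<in> strategy_combinations n \<Longrightarrow> ereal L \<le> social_cost n b c s" and L: "L > 0"
  shows "price_of_stability n b c \<le> 2"
proof -
  have num: "(INF s \<in> nash_equilibria n b c. social_cost n b c s) \<le> ereal (2 * L)"
    by (rule INF_lower2[where f = "social_cost n b c", OF eq])
  have den: "ereal L \<le> (INF s \<in> strategy_combinations n. social_cost n b c s)"
    using opt by (rule INF_greatest)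
  let ?D = "INF s \<in> strategy_combinations n. social_cost n b c s"
  have "price_of_stability n b c \<le> ereal (2 * L) / ?D"
    unfolding price_of_stability_def
    using num den L by (intro ereal_divide_right_mono) (auto intro: less_le_trans[of 0 "ereal L"])
  also have "\<dots> \<le> 2"
  proof (cases ?D)
    case (real d)
    then have "L \<le> d" using den by simp
    then show ?thesis using real L by (simp add: divide_le_eq)
  next
    case PInf
    \<comment> \<open>A real number divided by \<open>\<infinity>\<close> is 0.\<close>
    then show ?thesis by simp
  next
    case MInf
    then show ?thesis using den by simp
  qed
  finally show ?thesis .
qed

theorem corollary5:
  shows "\<exists>C :: real. \<forall>(n :: nat) (b :: real) (c :: real).
           n \<ge> 2 \<longrightarrow> b \<ge> 0 \<longrightarrow> c > 0 \<longrightarrow> c > 1 \<or> b + c < 1 / (real n)\<^sup>2 \<longrightarrow>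
           price_of_stability n b c \<le> ereal C"
proof (intro exI[of _ 2] allI impI)
  fix n :: nat and b c :: real
  assume n: "n \<ge> 2" and b: "b \<ge> 0" and c: "c > 0"
    and cases: "c > 1 \<or> b + c < 1 / (real n)\<^sup>2"
  have "price_of_stability n b c \<le> 2"
  proof (cases "c > 1")
    case True
    \<comment> \<open>This is the general lower bound for \<open>c \<ge> 1\<close>; doubled, it
      exceeds the cost bound of the complete graph by \<open>n (n - 1) / 2\<close>.\<close>
    let ?L = "(real n * (real n - 1) + b * (real n * ((real n - 1) * (real n - 2)))) / 2"
    have nonneg: "0 \<le> b * (real n * ((real n - 1) * (real n - 2)))" using n b by simp
    have pos: "0 < real n * (real n - 1)" using n by simp
    show ?thesis
    proof (rule price_of_stability_le[of "complete_profile n" _ _ _ ?L])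
      show "complete_profile n \<in> nash_equilibria n b c"
        using n b True by (intro complete_profile_nash) auto
      have "social_cost n b c (complete_profile n)
          \<le> ereal (real n * (real n - 1) / 2 + b * (real n * ((real n - 1) * (real n - 2))))"
        using n b c by (intro social_cost_complete_le) auto
      also have "\<dots> \<le> ereal (2 * ?L)" using pos by simp
      finally show "social_cost n b c (complete_profile n) \<le> ereal (2 * ?L)" .
      show "?L > 0" using pos nonneg by simp
    qed (use b True in \<open>auto intro: social_cost_ge_if_closeness_dominates\<close>)
  next
    case False
    then have small: "b + c < 1 / (real n)\<^sup>2" using cases by simp
    show ?thesis
    proof (rule price_of_stability_le)
      show "star_profile n \<in> nash_equilibria n b c" by (rule star_profile_nash[OF n b c small])
      show "social_cost n b c (star_profile n) \<le> ereal (2 * (real n - 1))"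
        by (rule social_cost_star_le[OF n b c small])
      show "ereal (real n - 1) \<le> social_cost n b c s" if "s \<in> strategy_combinations n" for s
        using that n b c by (intro social_cost_ge_channels) auto
    qed (use n in simp)
  qed
  then show "price_of_stability n b c \<le> ereal 2" by simp
qed

end
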